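(* Suppose $m,n,k$ are natural numbers such that $2\leq n$, $n+1\leq m$, $1\leq k\leq n-1$, and $n=\left\lfloor\frac{m+k}{2}\right\rfloor$. Then there exists a Riemannian metric $g_{m,n,k}$ on $\mathbb{R}^m$ such that the flat Euclidean space $\mathbb{R}^n$ admits an isometric immersion $f:\mathbb{R}^n\to(\mathbb{R}^m,g_{m,n,k})$, and for every set of orthonormal vectors $u,e_1,\dots,e_k$ tangent to $\mathbb{R}^n$ at the origin, $$\sum_{i=1}^k\mathrm{sec}(f_*(u),f_*(e_i))>0,$$ where $\mathrm{sec}$ denotes the sectional curvature of $(\mathbb{R}^m,g_{m,n,k})$.
   Context: $\mathrm{sec}(x,y)$ denotes the sectional curvature of the plane spanned by the linearly independent tangent vectors $x,y$. $f_*$ denotes the differential of $f$ at the origin of $\mathbb{R}^n$. *)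

theory Defs
  imports "HOL-Analysis.Analysis"
begin

text \<open>
  Every tangent space of \<open>real ^ 'm\<close> is identified with \<open>real ^ 'm\<close> in the usual way, so a vector
  field is a map \<open>real ^ 'm \<Rightarrow> real ^ 'm\<close>, and the differential of \<open>f\<close> at \<open>p\<close> is
  \<open>frechet_derivative f (at p)\<close>.
\<close>

primrec Ck_map :: "nat \<Rightarrow> ('a::euclidean_space \<Rightarrow> 'b::euclidean_space) \<Rightarrow> bool" where
  "Ck_map 0 f \<longleftrightarrow> continuous_on UNIV f"
| "Ck_map (Suc r) f \<longleftrightarrow>
     (\<forall>x. f differentiable (at x)) \<and> (\<forall>v. Ck_map r (\<lambda>x. frechet_derivative f (at x) v))"

definition smooth_map :: "('a::euclidean_space \<Rightarrow> 'b::euclidean_space) \<Rightarrow> bool" where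
  "smooth_map f \<longleftrightarrow> (\<forall>r. Ck_map r f)"

text \<open>\<open>g p v w\<close> is the inner product of the vectors \<open>v\<close> and \<open>w\<close> tangent at \<open>p\<close>.\<close>

type_synonym 'm metric_field = "real ^ 'm \<Rightarrow> real ^ 'm \<Rightarrow> real ^ 'm \<Rightarrow> real"

definition riemannian_metric :: "'m::finite metric_field \<Rightarrow> bool" where
  "riemannian_metric g \<longleftrightarrow>
     (\<forall>p. bilinear (g p)) \<and>
     (\<forall>p v w. g p v w = g p w v) \<and>
     (\<forall>p v. v \<noteq> 0 \<longrightarrow> 0 < g p v v) \<and>
     (\<forall>v w. smooth_map (\<lambda>p. g p v w))"

definition gram_matrix :: "'m::finite metric_field \<Rightarrow> real ^ 'm \<Rightarrow> real ^ 'm ^ 'm" where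
  "gram_matrix g p = (\<chi> i j. g p (axis i 1) (axis j 1))"

text \<open>
  The Christoffel symbols of the Levi-Civita connection, as a bilinear map of \<open>v\<close> and \<open>w\<close>:
  for \<open>v = axis i 1\<close> and \<open>w = axis j 1\<close> the component \<open>k\<close> of \<open>christoffel g p v w\<close> is the classical
  \<open>\<Gamma>\<^sup>k\<^sub>i\<^sub>j\<close>, that is \<open>1/2\<close> times the sum over \<open>l\<close> of
  \<open>g\<^sup>k\<^sup>l (\<partial>\<^sub>i g\<^sub>j\<^sub>l + \<partial>\<^sub>j g\<^sub>i\<^sub>l - \<partial>\<^sub>l g\<^sub>i\<^sub>j)\<close>.
\<close>

definition christoffel ::
  "'m::finite metric_field \<Rightarrow> real ^ 'm \<Rightarrow> real ^ 'm \<Rightarrow> real ^ 'm \<Rightarrow> real ^ 'm" where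
  "christoffel g p v w =
     (1 / 2) *\<^sub>R (matrix_inv (gram_matrix g p) *v
       (\<chi> l. frechet_derivative (\<lambda>q. g q w (axis l 1)) (at p) v
           + frechet_derivative (\<lambda>q. g q v (axis l 1)) (at p) w
           - frechet_derivative (\<lambda>q. g q v w) (at p) (axis l 1)))"

definition covariant_deriv ::
  "'m::finite metric_field \<Rightarrow> (real ^ 'm \<Rightarrow> real ^ 'm) \<Rightarrow> (real ^ 'm \<Rightarrow> real ^ 'm) \<Rightarrow>
   real ^ 'm \<Rightarrow> real ^ 'm" where
  "covariant_deriv g X Y p =
     frechet_derivative Y (at p) (X p) + christoffel g p (X p) (Y p)"

definition lie_bracket ::
  "(real ^ 'm::finite \<Rightarrow> real ^ 'm) \<Rightarrow> (real ^ 'm \<Rightarrow> real ^ 'm) \<Rightarrow> real ^ 'm \<Rightarrow> real ^ 'm" where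
  "lie_bracket X Y p =
     frechet_derivative Y (at p) (X p) - frechet_derivative X (at p) (Y p)"

definition riemann_curvature ::
  "'m::finite metric_field \<Rightarrow> (real ^ 'm \<Rightarrow> real ^ 'm) \<Rightarrow> (real ^ 'm \<Rightarrow> real ^ 'm) \<Rightarrow>
   (real ^ 'm \<Rightarrow> real ^ 'm) \<Rightarrow> real ^ 'm \<Rightarrow> real ^ 'm" where
  "riemann_curvature g X Y Z p =
     covariant_deriv g X (covariant_deriv g Y Z) p
     - covariant_deriv g Y (covariant_deriv g X Z) p
     - covariant_deriv g (lie_bracket X Y) Z p"

text \<open>
  The curvature at \<open>p\<close> depends only on the values of the three fields at \<open>p\<close>; the tangent vectors
  \<open>x\<close> and \<open>y\<close> are extended to constant vector fields. The value is meaningful for linearly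
  independent \<open>x\<close> and \<open>y\<close>. With this sign the round spheres have positive sectional curvature.
\<close>

definition sectional_curvature ::
  "'m::finite metric_field \<Rightarrow> real ^ 'm \<Rightarrow> real ^ 'm \<Rightarrow> real ^ 'm \<Rightarrow> real" where
  "sectional_curvature g p x y =
     g p (riemann_curvature g (\<lambda>_. x) (\<lambda>_. y) (\<lambda>_. y) p) x
     / (g p x x * g p y y - (g p x y)\<^sup>2)"

text \<open>The domain \<open>real ^ 'n\<close> carries the flat metric given by the standard inner product.\<close>

definition flat_isometric_immersion ::
  "(real ^ 'n::finite \<Rightarrow> real ^ 'm::finite) \<Rightarrow> 'm metric_field \<Rightarrow> bool" where
  "flat_isometric_immersion f g \<longleftrightarrow>
     smooth_map f \<and>
     (\<forall>x. inj (frechet_derivative f (at x))) \<and>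
     (\<forall>x v w. g (f x) (frechet_derivative f (at x) v) (frechet_derivative f (at x) w) = v \<bullet> w)"

end

theory Submission
  imports Defs
begin

text \<open>
  On \<open>real ^ 'm\<close> take the diagonal metric \<open>\<Sum>\<^sub>i exp (q\<^sub>i \<bullet> p) dp\<^sub>i\<^sup>2\<close>, where \<open>q\<^sub>i = 0\<close> unless \<open>i\<close> is one of
  \<open>n\<close> tangential indices, and every \<open>q\<^sub>i\<close> is supported on the remaining, normal, indices. On the
  coordinate subspace \<open>real ^ 'n\<close> of the tangential indices all the exponents vanish, so it is flat;
  up to a factor \<open>-1/2\<close> its second fundamental form is \<open>\<beta>(x, y) = \<Sum>\<^sub>i x\<^sub>i y\<^sub>i q\<^sub>i\<close>, and the Gauss
  equation gives \<open>sec(x, y) = (|\<beta>(x, y)|\<^sup>2 - \<beta>(x, x) \<bullet> \<beta>(y, y)) / 4\<close> for orthonormal \<open>x\<close>, \<open>y\<close>.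

  Since \<open>m - n \<ge> n - k\<close>, one can choose \<open>n - k\<close> of the \<open>q\<^sub>i\<close> as independent vectors with negative
  mutual inner products, and the other \<open>k\<close> all equal to one small negative multiple of their sum.
  For \<open>i \<noteq> j\<close> a positive \<open>q\<^sub>i \<bullet> q\<^sub>j\<close>, which lowers the curvature, then occurs only among the last \<open>k\<close>.
  By Bessel's inequality \<open>u, e\<^sub>1, \<dots>, e\<^sub>k\<close> have total mass at most \<open>k\<close> on these \<open>k\<close> coordinates, which makes
  its contribution too small to spoil the positivity of the sum.
\<close>

section \<open>The diagonal exponential metric and its smoothness\<close>

definition exp_metric :: "('m::finite \<Rightarrow> real ^ 'm) \<Rightarrow> 'm metric_field" where
  "exp_metric q p v w = (\<Sum>i\<in>UNIV. (v $ i * w $ i) * exp (q i \<bullet> p))"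

lemma has_derivative_exp_sum:
  "((\<lambda>p. \<Sum>i\<in>UNIV. c i * exp (q i \<bullet> p)) has_derivative
     (\<lambda>d. \<Sum>i\<in>UNIV. c i * (q i \<bullet> d) * exp (q i \<bullet> p))) (at p)"
  for q :: "'m::finite \<Rightarrow> 'a::euclidean_space"
  by (auto intro!: derivative_eq_intros simp: algebra_simps)

text \<open>Differentiating in a fixed direction \<open>v\<close> only replaces \<open>c i\<close>
  by \<open>c i * (q i \<bullet> v)\<close>, so sums of this form are closed under derivatives;
  hence the induction generalizes over \<open>c\<close>.\<close>

lemma Ck_map_exp_sum:
  "Ck_map r (\<lambda>p. \<Sum>i\<in>UNIV. c i * exp (q i \<bullet> p))"
  for q :: "'m::finite \<Rightarrow> 'a::euclidean_space"
proof (induction r arbitrary: c)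
  case 0
  show ?case by (auto intro!: continuous_intros)
next
  case (Suc r)
  have "(\<lambda>p. \<Sum>i\<in>UNIV. c i * exp (q i \<bullet> p)) differentiable (at x)" for x
    using has_derivative_exp_sum unfolding differentiable_def by blast
  with Suc show ?case
    by (simp add: frechet_derivative_at[OF has_derivative_exp_sum, symmetric])
qed

lemma Ck_map_const: "Ck_map r (\<lambda>x. c)"
  by (induction r arbitrary: c) auto

lemma smooth_map_linear:
  assumes "linear f"
  shows "smooth_map f"
  unfolding smooth_map_def
proof
  fix r show "Ck_map r f"
  proof (cases r)
    case 0
    with assms show ?thesis by (simp add: linear_continuous_on linear_linear)
  next
    case (Suc r')
    have "(f has_derivative f) (at x)" for x
      using assms by (simp add: linear_imp_has_derivative)
    then have "f differentiable (at x)" "frechet_derivative f (at x) = f" for x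
      using frechet_derivative_at[of f f x] by (auto simp: differentiable_def)
    with Suc Ck_map_const show ?thesis by auto
  qed
qed

lemma riemannian_metric_exp_metric: "riemannian_metric (exp_metric q)"
  unfolding riemannian_metric_def
proof (intro conjI allI impI)
  fix p v w
  show "bilinear (exp_metric q p)"
    by (auto simp: bilinear_def exp_metric_def sum.distrib algebra_simps sum_distrib_left
        intro!: linearI)
  show "exp_metric q p v w = exp_metric q p w v"
    by (simp add: exp_metric_def mult.commute)
  show "smooth_map (\<lambda>p. exp_metric q p v w)"
    unfolding exp_metric_def smooth_map_def
    using Ck_map_exp_sum[of _ "\<lambda>i. v $ i * w $ i" q] by simp
next
  fix p v :: "real ^ 'a" assume "v \<noteq> 0"
  then obtain i where "v $ i \<noteq> 0" by (auto simp: vec_eq_iff)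
  then show "0 < exp_metric q p v v"
    unfolding exp_metric_def by (intro sum_pos2[where i = i]) (auto simp: zero_less_mult_iff)
qed

lemma frechet_derivative_exp_metric:
  "frechet_derivative (\<lambda>p. exp_metric q p v w) (at p)
     = (\<lambda>d. \<Sum>i\<in>UNIV. (v $ i * w $ i) * (q i \<bullet> d) * exp (q i \<bullet> p))"
  unfolding exp_metric_def by (rule frechet_derivative_at[OF has_derivative_exp_sum, symmetric])

section \<open>Christoffel symbols of the diagonal metric\<close>

lemma matrix_inv_unique:
  fixes A :: "'a::semiring_1 ^ 'n ^ 'm" and B :: "'a ^ 'm ^ 'n"
  assumes "A ** B = mat 1" and "B ** A = mat 1"
  shows "matrix_inv A = B"
  unfolding matrix_inv_def
proof (rule some_equality)
  show "A ** B = mat 1 \<and> B ** A = mat 1" using assms by simp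
  show "C = B" if "A ** C = mat 1 \<and> C ** A = mat 1" for C
    by (metis that assms(2) matrix_mul_assoc matrix_mul_lid matrix_mul_rid)
qed

lemma matrix_inv_diagonal:
  fixes d :: "'m::finite \<Rightarrow> real"
  assumes "\<And>i. d i \<noteq> 0"
  shows "matrix_inv (\<chi> i j. if i = j then d i else 0) = (\<chi> i j. if i = j then 1 / d i else 0)"
proof (rule matrix_inv_unique)
  have "(\<chi> i j. if i = j then a i else 0) ** (\<chi> i j. if i = j then b i else 0) = mat 1"
    if "\<And>i. a i * b i = 1" for a b :: "'m \<Rightarrow> real"
  proof -
    have "(\<Sum>k\<in>UNIV. (if i = k then a i else 0) * (if k = j then b k else 0))
        = (\<Sum>k\<in>UNIV. if k = i then (if i = j then 1 else 0) else 0)" for i j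
      using that by (intro sum.cong) auto
    then show ?thesis by (simp add: matrix_matrix_mult_def mat_def vec_eq_iff)
  qed
  then show "(\<chi> i j. if i = j then d i else 0) ** (\<chi> i j. if i = j then 1 / d i else 0) = mat 1"
    "(\<chi> i j. if i = j then 1 / d i else 0) ** (\<chi> i j. if i = j then d i else 0) = mat 1"
    using assms by simp_all
qed

text \<open>The Gram matrix is diagonal, so its inverse merely divides component \<open>l\<close> by
  \<open>exp (q l \<bullet> p)\<close>. This cancels the exponential in the first two terms and
  leaves differences of exponents in the third.\<close>

lemma christoffel_exp_metric:
  fixes q :: "'m::finite \<Rightarrow> real ^ 'm"
  shows
  "christoffel (exp_metric q) p v w $ l =
     ((q l \<bullet> v) * w $ l + (q l \<bullet> w) * v $ l
       - (\<Sum>i\<in>UNIV. q i $ l * exp ((q i - q l) \<bullet> p) * (v $ i * w $ i))) / 2"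
proof -
  have metric_axis: "exp_metric q p v (axis l 1) = v $ l * exp (q l \<bullet> p)" for p v l
  proof -
    have "exp_metric q p v (axis l 1) = (\<Sum>i\<in>UNIV. if i = l then v $ l * exp (q l \<bullet> p) else 0)"
      unfolding exp_metric_def by (intro sum.cong) (auto simp: axis_def)
    then show ?thesis by simp
  qed
  have deriv_axis: "frechet_derivative (\<lambda>p. exp_metric q p v (axis l 1)) (at p) d
      = v $ l * (q l \<bullet> d) * exp (q l \<bullet> p)" for v l d
  proof -
    have "frechet_derivative (\<lambda>p. exp_metric q p v (axis l 1)) (at p) d
        = (\<Sum>i\<in>UNIV. if i = l then v $ l * (q l \<bullet> d) * exp (q l \<bullet> p) else 0)"
      unfolding frechet_derivative_exp_metric by (intro sum.cong) (auto simp: axis_def)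
    then show ?thesis by simp
  qed
  have gram: "gram_matrix (exp_metric q) p = (\<chi> i j. if i = j then exp (q i \<bullet> p) else 0)"
    unfolding gram_matrix_def metric_axis by (auto simp: vec_eq_iff axis_def)
  have diag_mult: "((\<chi> i j. if i = j then b i else 0) *v a) $ l = b l * a $ l"
    for a :: "real ^ 'm" and b :: "'m \<Rightarrow> real" and l
  proof -
    have "((\<chi> i j. if i = j then b i else 0) *v a) $ l = (\<Sum>j\<in>UNIV. if j = l then b l * a $ l else 0)"
      unfolding matrix_vector_mult_def vec_lambda_beta by (intro sum.cong) auto
    then show ?thesis by simp
  qed
  have E: "exp ((q i - q l) \<bullet> p) = exp (q i \<bullet> p) / exp (q l \<bullet> p)" for i
    by (simp add: inner_diff_left exp_diff)
  have chr: "christoffel (exp_metric q) p v w $ l = (1 / exp (q l \<bullet> p)) *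
      (w $ l * (q l \<bullet> v) * exp (q l \<bullet> p) + v $ l * (q l \<bullet> w) * exp (q l \<bullet> p)
        - (\<Sum>i\<in>UNIV. v $ i * w $ i * q i $ l * exp (q i \<bullet> p))) / 2"
    unfolding christoffel_def gram matrix_inv_diagonal[OF exp_not_eq_zero] deriv_axis
    unfolding frechet_derivative_exp_metric
    by (simp add: diag_mult inner_axis)
  have sum: "(\<Sum>i\<in>UNIV. q i $ l * exp ((q i - q l) \<bullet> p) * (v $ i * w $ i)) =
      (1 / exp (q l \<bullet> p)) * (\<Sum>i\<in>UNIV. v $ i * w $ i * q i $ l * exp (q i \<bullet> p))"
    unfolding E sum_distrib_left by (intro sum.cong) auto
  show ?thesis unfolding chr sum by (simp add: field_simps)
qed

text \<open>The point enters the Christoffel symbols only through the exponents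
  \<open>(q i - q l) \<bullet> p\<close>, which are constant in the direction \<open>d\<close>. For
  tangential directions this removes the derivative terms from the curvature.\<close>

lemma frechet_derivative_christoffel_exp_metric:
  assumes "\<And>i. q i \<bullet> d = 0"
  shows "frechet_derivative (\<lambda>p. christoffel (exp_metric q) p v w) (at p) d = 0"
proof -
  let ?G = "\<lambda>p. christoffel (exp_metric q) p v w"
  let ?D = "\<lambda>d. \<chi> l. - (\<Sum>i\<in>UNIV. q i $ l * (((q i - q l) \<bullet> d) * exp ((q i - q l) \<bullet> p)) *
      (v $ i * w $ i)) / 2"
  have "(?G has_derivative ?D) (at p)"
    unfolding has_derivative_componentwise_within[of ?G]
  proof
    fix b :: "real ^ 'a" assume "b \<in> Basis"
    then obtain l where b: "b = axis l 1" by (auto simp: Basis_vec_def)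
    show "((\<lambda>p. ?G p \<bullet> b) has_derivative (\<lambda>d. ?D d \<bullet> b)) (at p)"
      unfolding b inner_axis christoffel_exp_metric
      by (auto intro!: derivative_eq_intros simp: algebra_simps)
  qed
  then show ?thesis
    using frechet_derivative_at[of ?G ?D] assms by (auto simp: vec_eq_iff inner_diff_left)
qed

section \<open>Curvature of tangential planes at the origin\<close>

text \<open>The form \<beta> described above. Index and value types are left free because it is
  taken both over the coordinates of the ambient space, with \<open>q\<close>, and over those of the
  flat space, with \<open>w\<close>.\<close>

definition diag_form :: "('n::finite \<Rightarrow> 'a::real_vector) \<Rightarrow> real ^ 'n \<Rightarrow> real ^ 'n \<Rightarrow> 'a" where
  "diag_form q x y = (\<Sum>i\<in>UNIV. (x $ i * y $ i) *\<^sub>R q i)"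

text \<open>Constant fields have zero derivative and commute, so only Christoffel terms remain. For
  an arbitrary \<open>g\<close> the contribution \<open>christoffel g p 0 z\<close> of the zero
  bracket need not vanish, so it is kept.\<close>

lemma riemann_curvature_const:
  "riemann_curvature g (\<lambda>_. x) (\<lambda>_. y) (\<lambda>_. z) p =
     frechet_derivative (\<lambda>p. christoffel g p y z) (at p) x + christoffel g p x (christoffel g p y z)
     - (frechet_derivative (\<lambda>p. christoffel g p x z) (at p) y
        + christoffel g p y (christoffel g p x z))
     - christoffel g p 0 z"
proof -
  have "covariant_deriv g (\<lambda>_. v) (\<lambda>_. z) = (\<lambda>p. christoffel g p v z)" for v
    by (simp add: covariant_deriv_def fun_eq_iff)
  moreover have "lie_bracket (\<lambda>_. x) (\<lambda>_. y) = (\<lambda>_. 0)"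
    by (simp add: lie_bracket_def fun_eq_iff)
  ultimately show ?thesis
    unfolding riemann_curvature_def by simp (simp add: covariant_deriv_def)
qed

text \<open>The Gauss equation, obtained by direct computation. At the origin all exponentials are
  1, so the metric there is the standard inner product; the derivative terms vanish on tangential
  vectors, and the two iterated Christoffel terms yield the two products of
  \<open>diag_form\<close>.\<close>

lemma sectional_curvature_exp_metric:
  fixes q :: "'m::finite \<Rightarrow> real ^ 'm"
  assumes normal: "\<And>i j. q i $ j \<noteq> 0 \<Longrightarrow> q j = 0"
    and x: "\<And>i. q i \<bullet> x = 0" and y: "\<And>i. q i \<bullet> y = 0"
    and unit: "x \<bullet> x = 1" "y \<bullet> y = 1" "x \<bullet> y = 0"
  shows "sectional_curvature (exp_metric q) 0 x y =
    (diag_form q x y \<bullet> diag_form q x y - diag_form q x x \<bullet> diag_form q y y) / 4"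
proof -
  let ?C = "christoffel (exp_metric q) 0"
  have g0: "exp_metric q 0 v w = v \<bullet> w" for v w
    by (simp add: exp_metric_def inner_vec_def)
  have C1: "?C v w = - (1 / 2) *\<^sub>R diag_form q v w"
    if "\<And>i. q i \<bullet> v = 0" "\<And>i. q i \<bullet> w = 0" for v w
    using that by (simp add: vec_eq_iff christoffel_exp_metric diag_form_def algebra_simps)
  have qq: "q i $ l * q j $ i = 0" for i j l
    using normal[of j i] by auto
  \<comment> \<open>A combination of the \<open>q i\<close> is supported on normal indices, where
    \<open>q\<close> itself vanishes by \<open>normal\<close>. Together with
    \<open>q l \<bullet> v = 0\<close> this leaves one of the three Christoffel terms.\<close>
  have C2: "?C v (c *\<^sub>R diag_form q a b) \<bullet> z = c / 2 * (diag_form q a b \<bullet> diag_form q v z)"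
    if "\<And>i. q i \<bullet> v = 0" for v a b c z
  proof -
    have "q i $ l * (diag_form q a b $ i) = 0" for i l
      unfolding diag_form_def sum_component sum_distrib_left
      using qq[of i l] by (intro sum.neutral) (auto simp: mult.left_commute)
    then have z: "(\<Sum>i\<in>UNIV. q i $ l * (v $ i * (c * diag_form q a b $ i))) = 0" for l
      by (intro sum.neutral) (auto simp: algebra_simps)
    have "?C v (c *\<^sub>R diag_form q a b) $ l = c / 2 * (q l \<bullet> diag_form q a b) * v $ l" for l
      using that z by (simp add: christoffel_exp_metric)
    then have "?C v (c *\<^sub>R diag_form q a b) \<bullet> z
        = (\<Sum>l\<in>UNIV. c / 2 * (q l \<bullet> diag_form q a b) * v $ l * z $ l)"
      by (simp only: inner_vec_def[of _ z] inner_real_def)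
    also have "\<dots> = c / 2 * (diag_form q a b \<bullet> diag_form q v z)"
      unfolding diag_form_def[of q v z] inner_sum_right sum_distrib_left
      by (intro sum.cong) (auto simp: inner_commute)
    finally show ?thesis .
  qed
  have C0: "?C 0 y = 0"
    by (simp add: vec_eq_iff christoffel_exp_metric)
  have "exp_metric q 0 (riemann_curvature (exp_metric q) (\<lambda>_. x) (\<lambda>_. y) (\<lambda>_. y) 0) x
     = ?C x (- (1 / 2) *\<^sub>R diag_form q y y) \<bullet> x - ?C y (- (1 / 2) *\<^sub>R diag_form q x y) \<bullet> x"
    unfolding riemann_curvature_const g0
      frechet_derivative_christoffel_exp_metric[OF x] frechet_derivative_christoffel_exp_metric[OF y]
      C1[OF y y] C1[OF x y] C0
    by (simp add: inner_diff_left)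
  also have "\<dots> = (diag_form q x y \<bullet> diag_form q x y - diag_form q x x \<bullet> diag_form q y y) / 4"
    unfolding C2[OF x] C2[OF y]
    by (simp add: diag_form_def[of q y x] diag_form_def[of q x y] mult.commute field_simps
        inner_commute)
  finally show ?thesis
    using unit by (simp add: sectional_curvature_def g0)
qed

section \<open>Positivity of the sum of the Gauss terms\<close>

text \<open>For the projection \<open>?y\<close> of \<open>v\<close> to the span of the family, both
  \<open>?y \<bullet> ?y\<close> and \<open>v \<bullet> ?y\<close> equal the left-hand side, so
  expanding the square of \<open>v - ?y\<close> gives the claim.\<close>

lemma bessel_inequality:
  fixes e :: "'i \<Rightarrow> 'a::real_inner"
  assumes "finite S" and "\<And>i. i \<in> S \<Longrightarrow> norm (e i) = 1"
    and "\<And>i j. i \<in> S \<Longrightarrow> j \<in> S \<Longrightarrow> i \<noteq> j \<Longrightarrow> orthogonal (e i) (e j)"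
  shows "(\<Sum>i\<in>S. (e i \<bullet> v)\<^sup>2) \<le> v \<bullet> v"
proof -
  let ?y = "\<Sum>i\<in>S. (e i \<bullet> v) *\<^sub>R e i"
  have "e i \<bullet> ?y = e i \<bullet> v" if "i \<in> S" for i
  proof -
    have "e i \<bullet> ?y = (\<Sum>j\<in>S. if j = i then e i \<bullet> v else 0)"
      unfolding inner_sum_right
      using assms(2,3) that by (intro sum.cong) (auto simp: orthogonal_def norm_eq_1)
    with assms(1) that show ?thesis by simp
  qed
  then have "?y \<bullet> ?y = (\<Sum>i\<in>S. (e i \<bullet> v)\<^sup>2)" and "v \<bullet> ?y = (\<Sum>i\<in>S. (e i \<bullet> v)\<^sup>2)"
    by (simp_all only: inner_sum_left inner_scaleR_left inner_sum_right[of v] inner_scaleR_right)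
      (simp_all add: power2_eq_square inner_commute)
  moreover have "0 \<le> (v - ?y) \<bullet> (v - ?y)" by simp
  ultimately show ?thesis by (simp add: inner_diff_left inner_diff_right inner_commute)
qed

text \<open>The Gram matrix of \<open>w\<close> may be replaced by one that is constant on the four
  blocks given by \<open>I\<close> and its complement, so the double sums factor. By
  \<open>orth\<close> the sum of \<open>x $ i * y $ i\<close> over the complement is the negative of
  that over \<open>I\<close>, so one such sum suffices.\<close>

lemma diag_form_gauss:
  fixes w :: "'n::finite \<Rightarrow> 'a::real_inner" and I :: "'n set"
  assumes II: "\<And>i j. i \<in> I \<Longrightarrow> j \<in> I \<Longrightarrow> i \<noteq> j \<Longrightarrow> w i \<bullet> w j = - d"
    and IK: "\<And>i j. i \<in> I \<Longrightarrow> j \<notin> I \<Longrightarrow> w i \<bullet> w j = - t"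
    and KK: "\<And>i j. i \<notin> I \<Longrightarrow> j \<notin> I \<Longrightarrow> i \<noteq> j \<Longrightarrow> w i \<bullet> w j = s"
    and orth: "x \<bullet> y = 0"
  shows "diag_form w x y \<bullet> diag_form w x y - diag_form w x x \<bullet> diag_form w y y =
    t * ((\<Sum>i\<in>I. (x $ i)\<^sup>2) * (\<Sum>i\<in>-I. (y $ i)\<^sup>2) + (\<Sum>i\<in>-I. (x $ i)\<^sup>2) * (\<Sum>i\<in>I. (y $ i)\<^sup>2))
    + 2 * t * (\<Sum>i\<in>I. x $ i * y $ i)\<^sup>2
    + d * ((\<Sum>i\<in>I. (x $ i)\<^sup>2) * (\<Sum>i\<in>I. (y $ i)\<^sup>2) - (\<Sum>i\<in>I. x $ i * y $ i)\<^sup>2)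
    - s * ((\<Sum>i\<in>-I. (x $ i)\<^sup>2) * (\<Sum>i\<in>-I. (y $ i)\<^sup>2) - (\<Sum>i\<in>I. x $ i * y $ i)\<^sup>2)"
proof -
  define G where "G i j = (if i \<in> I then if j \<in> I then - d else - t else if j \<in> I then - t else s)"
    for i j
  have G: "w i \<bullet> w j = G i j" if "i \<noteq> j" for i j
    using that II IK[of i j] IK[of j i] KK by (auto simp: G_def inner_commute)
  have GS: "(\<Sum>i\<in>UNIV. \<Sum>j\<in>UNIV. a i * b j * G i j) =
      - d * (sum a I * sum b I) - t * (sum a I * sum b (-I) + sum a (-I) * sum b I)
      + s * (sum a (-I) * sum b (-I))" for a b :: "'n \<Rightarrow> real"
  proof -
    have split: "sum h UNIV = sum h I + sum h (-I)" for h :: "'n \<Rightarrow> real"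
      using sum.subset_diff[of I UNIV h] by (simp add: Compl_eq_Diff_UNIV)
    have block: "(\<Sum>i\<in>X. \<Sum>j\<in>Y. a i * b j * G i j) = g * (sum a X * sum b Y)"
      if "\<And>i j. i \<in> X \<Longrightarrow> j \<in> Y \<Longrightarrow> G i j = g" for X Y g
      unfolding sum_product unfolding sum_distrib_left
      by (intro sum.cong refl) (simp add: that)
    have "(\<Sum>i\<in>I. \<Sum>j\<in>I. a i * b j * G i j) = - d * (sum a I * sum b I)"
      "(\<Sum>i\<in>I. \<Sum>j\<in>-I. a i * b j * G i j) = - t * (sum a I * sum b (-I))"
      "(\<Sum>i\<in>-I. \<Sum>j\<in>I. a i * b j * G i j) = - t * (sum a (-I) * sum b I)"
      "(\<Sum>i\<in>-I. \<Sum>j\<in>-I. a i * b j * G i j) = s * (sum a (-I) * sum b (-I))"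
      by (intro block; simp add: G_def)+
    then show ?thesis by (simp add: split sum.distrib algebra_simps)
  qed
  have inner: "diag_form w a b \<bullet> diag_form w a' b' =
      (\<Sum>i\<in>UNIV. \<Sum>j\<in>UNIV. (a $ i * b $ i) * (a' $ j * b' $ j) * (w i \<bullet> w j))" for a b a' b'
    unfolding diag_form_def inner_sum_left unfolding inner_sum_right
    by (simp add: mult_ac)
  have "diag_form w x y \<bullet> diag_form w x y - diag_form w x x \<bullet> diag_form w y y =
      (\<Sum>i\<in>UNIV. \<Sum>j\<in>UNIV. ((x $ i * y $ i) * (x $ j * y $ j) - (x $ i * x $ i) * (y $ j * y $ j))
        * (w i \<bullet> w j))"
    by (simp add: inner sum_subtractf left_diff_distrib)
  also have "\<dots> = (\<Sum>i\<in>UNIV. \<Sum>j\<in>UNIV.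
      ((x $ i * y $ i) * (x $ j * y $ j) - (x $ i * x $ i) * (y $ j * y $ j)) * G i j)"
  \<comment> \<open>On the diagonal, where \<open>G\<close> and the Gram matrix may differ, the
    coefficient is zero.\<close>
  proof (intro sum.cong refl)
    fix i j
    show "((x $ i * y $ i) * (x $ j * y $ j) - (x $ i * x $ i) * (y $ j * y $ j)) * (w i \<bullet> w j)
      = ((x $ i * y $ i) * (x $ j * y $ j) - (x $ i * x $ i) * (y $ j * y $ j)) * G i j"
      by (cases "i = j") (auto simp: G)
  qed
  also have "\<dots> = (\<Sum>i\<in>UNIV. \<Sum>j\<in>UNIV. (x $ i * y $ i) * (x $ j * y $ j) * G i j)
      - (\<Sum>i\<in>UNIV. \<Sum>j\<in>UNIV. (x $ i * x $ i) * (y $ j * y $ j) * G i j)"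
    by (simp add: sum_subtractf left_diff_distrib)
  finally have *: "diag_form w x y \<bullet> diag_form w x y - diag_form w x x \<bullet> diag_form w y y = \<dots>" .
  have "(\<Sum>i\<in>I. x $ i * y $ i) + (\<Sum>i\<in>-I. x $ i * y $ i) = 0"
    using orth sum.subset_diff[of I UNIV "\<lambda>i. x $ i * y $ i"]
    by (simp add: inner_vec_def Compl_eq_Diff_UNIV)
  then have K: "(\<Sum>i\<in>-I. x $ i * y $ i) = - (\<Sum>i\<in>I. x $ i * y $ i)"
    by simp
  show ?thesis
    unfolding * GS K by (simp add: power2_eq_square algebra_simps)
qed

text \<open>Summing the Gauss terms gives an expression in the masses \<open>A\<close>,
  \<open>B\<close> of \<open>u\<close> and \<alpha>, \<beta> of the \<open>e i\<close> on
  \<open>I\<close> and its complement, and in \<open>D\<close>. By Cauchy-Schwarz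
  \<open>D \<le> A * \<alpha>\<close>, so the only negative contribution is
  \<open>- s * (B * \<beta>)\<close>, which the terms with factor \<open>t\<close> must
  absorb.\<close>

lemma sum_gauss_pos:
  fixes w :: "'n::finite \<Rightarrow> 'a::real_inner" and I :: "'n set" and k :: nat
  assumes II: "\<And>i j. i \<in> I \<Longrightarrow> j \<in> I \<Longrightarrow> i \<noteq> j \<Longrightarrow> w i \<bullet> w j = - d"
    and IK: "\<And>i j. i \<in> I \<Longrightarrow> j \<notin> I \<Longrightarrow> w i \<bullet> w j = - t"
    and KK: "\<And>i j. i \<notin> I \<Longrightarrow> j \<notin> I \<Longrightarrow> i \<noteq> j \<Longrightarrow> w i \<bullet> w j = s"
    and k: "card (- I) = k" "1 \<le> k"
    and pos: "0 < d" "0 < s" "2 * s * k < t"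
    and u: "norm u = 1" and e: "\<And>i. i \<in> {1..k} \<Longrightarrow> norm (e i) = 1"
    and ue: "\<And>i. i \<in> {1..k} \<Longrightarrow> orthogonal u (e i)"
    and ee: "\<And>i j. i \<in> {1..k} \<Longrightarrow> j \<in> {1..k} \<Longrightarrow> i \<noteq> j \<Longrightarrow> orthogonal (e i) (e j)"
  shows "0 < (\<Sum>i = 1..k. diag_form w u (e i) \<bullet> diag_form w u (e i)
    - diag_form w u u \<bullet> diag_form w (e i) (e i))"
proof -
  define A B where "A = (\<Sum>i\<in>I. (u $ i)\<^sup>2)" and "B = (\<Sum>i\<in>-I. (u $ i)\<^sup>2)"
  define \<alpha> \<beta> where "\<alpha> = (\<Sum>l = 1..k. \<Sum>i\<in>I. (e l $ i)\<^sup>2)"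
    and "\<beta> = (\<Sum>l = 1..k. \<Sum>i\<in>-I. (e l $ i)\<^sup>2)"
  define D where "D = (\<Sum>l = 1..k. (\<Sum>i\<in>I. u $ i * e l $ i)\<^sup>2)"
  have split: "sum h I + sum h (-I) = sum h UNIV" for h :: "'n \<Rightarrow> real"
    using sum.subset_diff[of I UNIV h] by (simp add: Compl_eq_Diff_UNIV)
  have norm1: "(\<Sum>i\<in>UNIV. (v $ i)\<^sup>2) = 1" if "norm v = 1" for v :: "real ^ 'n"
    using that by (simp add: norm_eq_1 inner_vec_def power2_eq_square)
  have AB: "A + B = 1"
    unfolding A_def B_def split by (rule norm1[OF u])
  have ab: "\<alpha> + \<beta> = k"
    unfolding \<alpha>_def \<beta>_def sum.distrib[symmetric] split using norm1[OF e] by simp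
  have nonneg: "0 \<le> A" "0 \<le> B" "0 \<le> \<alpha>" "0 \<le> \<beta>" "0 \<le> D"
    by (auto simp: A_def B_def \<alpha>_def \<beta>_def D_def intro!: sum_nonneg)
  have DA: "D \<le> A * \<alpha>"
    unfolding D_def A_def \<alpha>_def sum_distrib_left[of _ _ "{1..k}"]
    by (intro sum_mono) (rule Cauchy_Schwarz_ineq_sum)
  \<comment> \<open>The update \<open>e(0 := u)\<close> joins \<open>u\<close> and the
    \<open>e i\<close> into one orthonormal family over \<open>{0..k}\<close>. Bessel is applied to
    each of the \<open>k\<close> unit vectors \<open>axis i 1\<close> with \<open>i\<close> outside
    \<open>I\<close>; comparison with \<open>ab\<close> then gives
    \<open>B \<le> \<alpha>\<close>.\<close>
  have "B + \<beta> = (\<Sum>i\<in>-I. \<Sum>l\<in>{0..k}. ((e(0 := u)) l \<bullet> axis i 1)\<^sup>2)"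
    unfolding B_def \<beta>_def sum.swap[of _ _ "{1..k}"] sum.distrib[symmetric]
    by (simp add: inner_axis sum.atLeast_Suc_atMost)
  also have "\<dots> \<le> (\<Sum>i\<in>-I. (axis i 1 :: real ^ 'n) \<bullet> axis i 1)"
    using u e ue ee
    by (intro sum_mono bessel_inequality) (auto simp: orthogonal_commute)
  also have "\<dots> = k"
    using k by (simp add: inner_axis_axis)
  finally have Ba: "B \<le> \<alpha>"
    using ab by simp
  have "0 < t * (A * \<beta> + B * \<alpha>) + 2 * t * D + d * (A * \<alpha> - D) - s * (B * \<beta> - D)" (is "_ < ?F")
  proof -
    have k1: "1 \<le> real k" using k by simp
    have ts: "2 * s < t" using pos k1 mult_left_mono[of 1 "real k" "2 * s"] by linarith
    show ?thesis
    proof (cases "B = 0")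
      case True
      \<comment> \<open>Here \<open>u\<close> lives on \<open>I\<close>, so the partial inner
        products in \<open>D\<close> are full ones and vanish. What remains is positive since
        \<alpha> and \<beta> add up to \<open>k\<close>.\<close>
      then have "u $ i = 0" if "i \<notin> I" for i
        using that unfolding B_def by (subst (asm) sum_nonneg_eq_0_iff) auto
      then have "(\<Sum>i\<in>I. u $ i * e l $ i) = u \<bullet> e l" for l
        unfolding inner_vec_def inner_real_def by (intro sum.mono_neutral_left) auto
      then have D0: "D = 0"
        unfolding D_def using ue by (auto simp: orthogonal_def)
      have "0 < t * \<beta> + d * \<alpha>"
      proof (cases "\<beta> = 0")
        case True
        then show ?thesis using ab k1 pos by simp
      next
        case False
        then show ?thesis using nonneg pos ts by (intro add_pos_nonneg) auto
      qed
      then show ?thesis using True D0 AB by simp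
    next
      case False
      then have B: "0 < B" using nonneg by simp
      \<comment> \<open>If \<open>A\<close> is at least 1/2, then \<open>B \<le> 2 * A\<close> and
        \<open>t * (A * \<beta>)\<close> suffices, strictly because \<open>B * \<alpha>\<close> is
        positive. Otherwise \<alpha> \<ge> \<open>B\<close> > 1/2, and \<beta> \<le>
        \<open>k\<close> with \<open>2 * s * k < t\<close> lets \<open>t * (B * \<alpha>)\<close>
        dominate.\<close>
      have "s * (B * \<beta>) < t * (A * \<beta> + B * \<alpha>)"
      proof (cases "1 / 2 \<le> A")
        case True
        have "s * (B * \<beta>) \<le> s * ((2 * A) * \<beta>)"
          using True AB nonneg pos by (intro mult_left_mono mult_right_mono) auto
        also have "\<dots> = (2 * s) * (A * \<beta>)" by simp
        also have "\<dots> \<le> t * (A * \<beta>)"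
          using ts nonneg by (intro mult_right_mono) auto
        also have "\<dots> < t * (A * \<beta> + B * \<alpha>)"
          using B Ba ts pos by (intro mult_strict_left_mono) auto
        finally show ?thesis .
      next
        case False
        have "s * (B * \<beta>) \<le> s * (B * k)"
          using ab nonneg pos by (intro mult_left_mono) auto
        also have "\<dots> = (2 * s * k) * (B * (1 / 2))" by simp
        also have "\<dots> < t * (B * (1 / 2))"
          using pos B by (intro mult_strict_right_mono) auto
        also have "\<dots> \<le> t * (A * \<beta> + B * \<alpha>)"
          using False AB Ba nonneg ts pos
          by (intro mult_left_mono add_increasing mult_nonneg_nonneg) auto
        finally show ?thesis .
      qed
      moreover have "0 \<le> d * (A * \<alpha> - D)" "0 \<le> 2 * t * D" "0 \<le> s * D"
        using DA pos nonneg ts by auto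
      ultimately show ?thesis unfolding right_diff_distrib[of s] by linarith
    qed
  qed
  also have "?F = (\<Sum>i = 1..k. diag_form w u (e i) \<bullet> diag_form w u (e i)
      - diag_form w u u \<bullet> diag_form w (e i) (e i))"
  proof -
    have "(\<Sum>l = 1..k. diag_form w u (e l) \<bullet> diag_form w u (e l)
        - diag_form w u u \<bullet> diag_form w (e l) (e l)) =
      (\<Sum>l = 1..k. t * (A * (\<Sum>i\<in>-I. (e l $ i)\<^sup>2) + B * (\<Sum>i\<in>I. (e l $ i)\<^sup>2))
        + 2 * t * (\<Sum>i\<in>I. u $ i * e l $ i)\<^sup>2
        + d * (A * (\<Sum>i\<in>I. (e l $ i)\<^sup>2) - (\<Sum>i\<in>I. u $ i * e l $ i)\<^sup>2)
        - s * (B * (\<Sum>i\<in>-I. (e l $ i)\<^sup>2) - (\<Sum>i\<in>I. u $ i * e l $ i)\<^sup>2))"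
      unfolding A_def B_def
      by (intro sum.cong refl diag_form_gauss[OF II IK KK]) (use ue in \<open>auto simp: orthogonal_def\<close>)
    also have "\<dots> = ?F"
      unfolding \<alpha>_def \<beta>_def D_def
      by (simp only: sum.distrib sum_subtractf sum_distrib_left[symmetric])
    finally show ?thesis by simp
  qed
  finally show ?thesis .
qed

section \<open>Choice of the exponent vectors\<close>

lemma exists_simplex_like_vectors:
  fixes I :: "'n::finite set" and J :: "'m::finite set" and k :: nat
  assumes "I \<noteq> {}" and "card I \<le> card J" and "1 \<le> k"
  obtains w :: "'n \<Rightarrow> real ^ 'm" and d t s :: real
  where "\<And>i j. i \<in> I \<Longrightarrow> j \<in> I \<Longrightarrow> i \<noteq> j \<Longrightarrow> w i \<bullet> w j = - d"
    and "\<And>i j. i \<in> I \<Longrightarrow> j \<notin> I \<Longrightarrow> w i \<bullet> w j = - t"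
    and "\<And>i j. i \<notin> I \<Longrightarrow> j \<notin> I \<Longrightarrow> i \<noteq> j \<Longrightarrow> w i \<bullet> w j = s"
    and "0 < d" and "0 < s" and "2 * s * k < t"
    and "\<And>i j. j \<notin> J \<Longrightarrow> w i $ j = 0"
proof -
  obtain \<nu> where \<nu>: "\<nu> ` I \<subseteq> J" "inj_on \<nu> I"
    using card_le_inj[OF _ _ assms(2)] by auto
  define c where "c = real (card I)"
  have c: "0 < c" using assms(1) by (simp add: c_def card_gt_0_iff)
  define S where "S = (\<Sum>i\<in>I. axis (\<nu> i) (1 :: real))"
  \<comment> \<open>With this value \<open>4 * r * k * c = 1 / 2\<close>, which is below 1 as
    \<open>2 * (r\<^sup>2 * c) * k < r / 2\<close> demands.\<close>
  define r where "r = 1 / (8 * k * c)"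
  have k: "0 < real k" using assms(3) by simp
  have r: "0 < r" using c k by (simp add: r_def)
  \<comment> \<open>Subtracting \<open>(1 / c) *\<^sub>R S\<close> would centre the axes and make
    them orthogonal to \<open>S\<close>. Half of it already makes the mutual products negative,
    namely \<open>- 3 / (4 * c)\<close>, but keeps the product with \<open>S\<close> at 1/2, so that
    \<open>- r *\<^sub>R S\<close> has product \<open>- r / 2\<close> with each.\<close>
  define w where "w i = (if i \<in> I then axis (\<nu> i) 1 - (1 / (2 * c)) *\<^sub>R S else - r *\<^sub>R S)" for i
  have aa: "axis (\<nu> i) (1::real) \<bullet> axis (\<nu> j) 1 = (if i = j then 1 else 0)"
    if "i \<in> I" "j \<in> I" for i j
    using that \<nu>(2) by (auto simp: inner_axis_axis inj_on_eq_iff)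
  have aS: "axis (\<nu> i) 1 \<bullet> S = 1" "S \<bullet> axis (\<nu> i) 1 = 1" if "i \<in> I" for i
    using that unfolding S_def inner_sum_right inner_sum_left by (simp_all add: aa)
  have SS: "S \<bullet> S = c"
    using aS(1) by (subst (1) S_def) (simp add: inner_sum_left c_def)
  show thesis
  proof
    show "w i \<bullet> w j = - (3 / (4 * c))" if "i \<in> I" "j \<in> I" "i \<noteq> j" for i j
      using that c by (simp add: w_def inner_diff_left inner_diff_right aa aS SS field_simps)
    show "w i \<bullet> w j = - (r / 2)" if "i \<in> I" "j \<notin> I" for i j
      using that c by (simp add: w_def inner_diff_left inner_diff_right aS SS field_simps)
    show "w i \<bullet> w j = r\<^sup>2 * c" if "i \<notin> I" "j \<notin> I" "i \<noteq> j" for i j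
      using that by (simp add: w_def SS power2_eq_square)
    show "2 * (r\<^sup>2 * c) * k < r / 2"
      using c k by (simp add: r_def power2_eq_square field_simps)
    show "w i $ j = 0" if "j \<notin> J" for i j
    proof -
      have "axis (\<nu> i) (1 :: real) $ j = 0" if "i \<in> I" for i
        using that \<open>j \<notin> J\<close> \<nu>(1) by (auto simp: axis_def)
      then show ?thesis by (simp add: w_def S_def)
    qed
  qed (use c r in auto)
qed

section \<open>Construction of the metric and the immersion\<close>

theorem proposition4p1:
  fixes m n k :: nat
  assumes "CARD('m::finite) = m" and "CARD('n::finite) = n"
    and "2 \<le> n" and "n + 1 \<le> m" and "1 \<le> k" and "k \<le> n - 1"
    and "int n = \<lfloor>(real m + real k) / 2\<rfloor>"
  shows "\<exists>g :: 'm metric_field. riemannian_metric g \<and>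
    (\<exists>f :: real ^ 'n \<Rightarrow> real ^ 'm. flat_isometric_immersion f g \<and>
      (\<forall>(u :: real ^ 'n) (e :: nat \<Rightarrow> real ^ 'n).
        norm u = 1 \<and> (\<forall>i\<in>{1..k}. norm (e i) = 1) \<and>
        (\<forall>i\<in>{1..k}. orthogonal u (e i)) \<and>
        (\<forall>i\<in>{1..k}. \<forall>j\<in>{1..k}. i \<noteq> j \<longrightarrow> orthogonal (e i) (e j)) \<longrightarrow>
        0 < (\<Sum>i = 1..k. sectional_curvature g (f 0)
              (frechet_derivative f (at 0) u) (frechet_derivative f (at 0) (e i)))))"
proof -
  obtain \<iota> :: "'n \<Rightarrow> 'm" where \<iota>: "inj \<iota>"
    using card_le_inj[of "UNIV :: 'n set" "UNIV :: 'm set"] assms by auto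
  have cardk: "k \<le> card (UNIV :: 'n set)" using assms by simp
  then obtain K :: "'n set" where K: "card K = k"
    using obtain_subset_with_card_n by blast
  define I where "I = - K"
  have "card I = n - k"
    using K assms by (simp add: I_def Compl_eq_Diff_UNIV card_Diff_subset)
  moreover have "card (- range \<iota>) = m - n"
    using assms \<iota> by (simp add: Compl_eq_Diff_UNIV card_Diff_subset card_image)
  \<comment> \<open>In the form \<open>n - k \<le> m - n\<close> this says that the normal
    directions have room for the \<open>n - k\<close> vectors indexed by \<open>I\<close>.\<close>
  moreover have "2 * n \<le> m + k"
  proof -
    have "real n \<le> (real m + real k) / 2"
      using of_int_floor_le[of "(real m + real k) / 2"] unfolding assms(7)[symmetric] by simp
    then have "real (2 * n) \<le> real (m + k)" by simp
    then show ?thesis by (simp only: of_nat_le_iff)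
  qed
  ultimately have card: "card I \<le> card (- range \<iota>)" and "I \<noteq> {}"
    using assms by auto
  from exists_simplex_like_vectors[OF this(2,1) assms(5)]
  obtain w :: "'n \<Rightarrow> real ^ 'm" and d t s where
    w: "\<And>i j. i \<in> I \<Longrightarrow> j \<in> I \<Longrightarrow> i \<noteq> j \<Longrightarrow> w i \<bullet> w j = - d"
      "\<And>i j. i \<in> I \<Longrightarrow> j \<notin> I \<Longrightarrow> w i \<bullet> w j = - t"
      "\<And>i j. i \<notin> I \<Longrightarrow> j \<notin> I \<Longrightarrow> i \<noteq> j \<Longrightarrow> w i \<bullet> w j = s"
    and pos: "0 < d" "0 < s" "2 * s * k < t"
    and w0: "\<And>i j. j \<notin> - range \<iota> \<Longrightarrow> w i $ j = 0"
    by blast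
  \<comment> \<open>The range of \<open>\<iota>\<close> is the set of tangential indices. By
    \<open>w0\<close> the vectors \<open>w i\<close> vanish there, so \<open>q\<close> is nonzero
    only at tangential indices and its values are supported on normal ones.\<close>
  define q where "q j = (if j \<in> range \<iota> then w (inv \<iota> j) else 0)" for j
  define f :: "real ^ 'n \<Rightarrow> real ^ 'm"
    where "f x = (\<chi> j. if j \<in> range \<iota> then x $ inv \<iota> j else 0)" for x
  have f_\<iota>: "f x $ \<iota> i = x $ i" for x i
    using \<iota> by (simp add: f_def)
  have f_out: "f x $ j = 0" if "j \<notin> range \<iota>" for x j
    using that by (simp add: f_def)
  have q_\<iota>: "q (\<iota> i) = w i" for i
    using \<iota> by (simp add: q_def)
  have sum_f: "(\<Sum>j\<in>UNIV. h j) = (\<Sum>i\<in>UNIV. h (\<iota> i))"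
    if "\<And>j. j \<notin> range \<iota> \<Longrightarrow> h j = 0" for h :: "'m \<Rightarrow> 'z::comm_monoid_add"
  proof -
    have "(\<Sum>j\<in>UNIV. h j) = sum h (range \<iota>)"
      using that by (intro sum.mono_neutral_right) auto
    then show ?thesis using \<iota> by (simp add: sum.reindex)
  qed
  have inner_f: "f x \<bullet> f y = x \<bullet> y" for x y
    unfolding inner_vec_def by (subst sum_f) (auto simp: f_out f_\<iota>)
  have qf: "q i \<bullet> f x = 0" for i x
    unfolding inner_vec_def
    by (intro sum.neutral) (auto simp: q_def f_def w0)
  have "linear f"
    by (rule linearI) (auto simp: f_def vec_eq_iff)
  then have deriv: "frechet_derivative f (at x) = f" for x
    using frechet_derivative_at[of f f] by (simp add: linear_imp_has_derivative)
  have f0: "f 0 = 0"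
    by (rule linear_0[OF \<open>linear f\<close>])
  have "inj f"
    by (rule injI) (metis f_\<iota> vec_eq_iff)
  \<comment> \<open>By \<open>qf\<close> all exponents vanish along the image of \<open>f\<close>,
    so the metric there is the standard inner product, which \<open>f\<close> preserves.\<close>
  then have imm: "flat_isometric_immersion f (exp_metric q)"
    unfolding flat_isometric_immersion_def deriv
    using smooth_map_linear[OF \<open>linear f\<close>] inner_f
    by (auto simp: exp_metric_def qf) (auto simp: inner_vec_def)
  have normal: "q j = 0" if "q i $ j \<noteq> 0" for i j
    using that w0 by (auto simp: q_def split: if_splits)
  have form: "diag_form q (f x) (f y) = diag_form w x y" for x y
    unfolding diag_form_def by (subst sum_f) (auto simp: f_out f_\<iota> q_\<iota>)
  have "0 < (\<Sum>i = 1..k. sectional_curvature (exp_metric q) (f 0)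
              (frechet_derivative f (at 0) u) (frechet_derivative f (at 0) (e i)))"
    if u: "norm u = 1" and e: "\<forall>i\<in>{1..k}. norm (e i) = 1"
      and ue: "\<forall>i\<in>{1..k}. orthogonal u (e i)"
      and ee: "\<forall>i\<in>{1..k}. \<forall>j\<in>{1..k}. i \<noteq> j \<longrightarrow> orthogonal (e i) (e j)"
    for u :: "real ^ 'n" and e :: "nat \<Rightarrow> real ^ 'n"
  proof -
    have "sectional_curvature (exp_metric q) 0 (f u) (f (e i)) =
      (diag_form w u (e i) \<bullet> diag_form w u (e i) - diag_form w u u \<bullet> diag_form w (e i) (e i)) / 4"
      if "i \<in> {1..k}" for i
      using sectional_curvature_exp_metric[OF normal qf[of _ u] qf[of _ "e i"]] that u e ue
      by (simp add: inner_f form orthogonal_def norm_eq_1)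
    then have "(\<Sum>i = 1..k. sectional_curvature (exp_metric q) (f 0)
              (frechet_derivative f (at 0) u) (frechet_derivative f (at 0) (e i))) =
      (\<Sum>i = 1..k. diag_form w u (e i) \<bullet> diag_form w u (e i)
        - diag_form w u u \<bullet> diag_form w (e i) (e i)) / 4"
      unfolding deriv f0 sum_divide_distrib by (intro sum.cong) auto
    moreover have "0 < (\<Sum>i = 1..k. diag_form w u (e i) \<bullet> diag_form w u (e i)
        - diag_form w u u \<bullet> diag_form w (e i) (e i))"
    proof (rule sum_gauss_pos[where I = I and d = d and t = t and s = s])
      show "card (- I) = k" by (simp add: I_def K)
    qed (use w pos assms(5) u e ue ee in auto)
    ultimately show ?thesis by simp
  qed
  with imm riemannian_metric_exp_metric show ?thesis by blast
qed

end
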